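(* Let $\Theta=(J_3,J_5,\alpha,\beta)$ be an arbitrary Jacobi-type pencil, let $\{p_n(\lambda)\}_{n=0}^\infty$ be the polynomials associated to $\Theta$, and let $A$ be the associated operator for $\Theta$. Then $$\left(p_n(A)\vec e_0,\;p_m(A)\vec e_0\right)_{l_2}=\delta_{n,m},\qquad n,m\in\mathbb{Z}_+.$$
   Context: $\mathbb{Z}_+$ denotes the set of non-negative integers. $l_2$ is the Hilbert space of square-summable complex sequences $c=(c_n)_{n=0}^\infty$ with scalar product $(c,d)_{l_2}=\sum_{n=0}^\infty c_n\overline{d_n}$; $\vec e_m=(\delta_{n,m})_{n=0}^\infty$ for $m\in\mathbb{Z}_+$, and $\vec e_k=0$ for negative $k$; $l_{2,fin}$ is the set of vectors in $l_2$ with all but finitely many components zero. A Jacobi-type pencil is a set $\Theta=(J_3,J_5,\alpha,\beta)$, where $\alpha>0$, $\beta\in\mathbb{R}$, $J_3$ is a semi-infinite Jacobi matrix (real symmetric tridiagonal, with diagonal entries $b_k\in\mathbb{R}$ and off-diagonal entries $a_k>0$, $k\in\mathbb{Z}_+$), and $J_5$ is a semi-infinite real symmetric five-diagonal matrix with diagonal entries $\alpha_n\in\mathbb{R}$, first subdiagonal entries $\beta_n\in\mathbb{R}$ and second subdiagonal entries $\gamma_n>0$, $n\in\mathbb{Z}_+$. The polynomials associated to $\Theta$ are the uniquely determined polynomials $\{p_n(\lambda)\}_{n=0}^\infty$ with $p_0(\lambda)=1$, $p_1(\lambda)=\alpha\lambda+\beta$ and $(J_5-\lambda J_3)(p_0(\lambda),p_1(\lambda),p_2(\lambda),\dots)^T=0$;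 in scalar form, $$\gamma_{n-2}p_{n-2}(\lambda)+(\beta_{n-1}-\lambda a_{n-1})p_{n-1}(\lambda)+(\alpha_n-\lambda b_n)p_n(\lambda)+(\beta_n-\lambda a_n)p_{n+1}(\lambda)+\gamma_n p_{n+2}(\lambda)=0,\quad n\in\mathbb{Z}_+,$$ where terms containing $p_{-2}=p_{-1}=0$ are omitted. For $n\in\mathbb{Z}_+$ set $$u_n:=J_3\vec e_n=a_{n-1}\vec e_{n-1}+b_n\vec e_n+a_n\vec e_{n+1},$$ $$w_n:=J_5\vec e_n=\gamma_{n-2}\vec e_{n-2}+\beta_{n-1}\vec e_{n-1}+\alpha_n\vec e_n+\beta_n\vec e_{n+1}+\gamma_n\vec e_{n+2}$$ (terms with negative-index $\vec e_k$ vanish). Since $a_n>0$, the vectors $\vec e_0,u_0,u_1,u_2,\dots$ are linearly independent and their linear span is $l_{2,fin}$. The associated operator for $\Theta$ is the linear operator $A$ with domain $D(A)=l_{2,fin}$ given by $$Af=\frac{\zeta}{\alpha}(\vec e_1-\beta\vec e_0)+\sum_{n=0}^\infty\xi_n w_n\quad\text{for}\quad f=\zeta\vec e_0+\sum_{n=0}^\infty\xi_n u_n\in l_{2,fin},$$ where $\zeta,\xi_n\in\mathbb{C}$ and only finitely many $\xi_n$ are nonzero. It maps $l_{2,fin}$ into itself. For a polynomial $f(\lambda)=\sum_{k=0}^d d_k\lambda^k$ with complex coefficients, $f(A):=\sum_{k=0}^d d_kA^k$ on $l_{2,fin}$, with $A^0$ the identity on $l_{2,fin}$ (and $f(A)=0$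 on $l_{2,fin}$ if $f\equiv0$). *)

theory Defs
  imports Complex_Main "HOL-Computational_Algebra.Polynomial"
begin

text \<open>Complex sequences are functions \<open>nat \<Rightarrow> complex\<close>; linear combinations are taken pointwise.\<close>

definition l2 :: "(nat \<Rightarrow> complex) set"
  where "l2 = {c. summable (\<lambda>n. (cmod (c n))\<^sup>2)}"

definition l2_inner :: "(nat \<Rightarrow> complex) \<Rightarrow> (nat \<Rightarrow> complex) \<Rightarrow> complex"
  where "l2_inner c d = (\<Sum>n. c n * cnj (d n))"

definition l2_fin :: "(nat \<Rightarrow> complex) set"
  where "l2_fin = {c \<in> l2. finite {n. c n \<noteq> 0}}"

definition evec :: "nat \<Rightarrow> nat \<Rightarrow> complex"
  where "evec m = (\<lambda>n. if n = m then 1 else 0)"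

text \<open>Product of a semi-infinite matrix (row index first) with a sequence, intended for
  matrices with finitely many nonzero entries in each row.\<close>

definition mat_vec :: "(nat \<Rightarrow> nat \<Rightarrow> complex) \<Rightarrow> (nat \<Rightarrow> complex) \<Rightarrow> nat \<Rightarrow> complex"
  where "mat_vec M c = (\<lambda>i. \<Sum>j | M i j \<noteq> 0. M i j * c j)"

text \<open>The diagonals are \<open>b k = J k k\<close>, \<open>a k = J (Suc k) k\<close> in the first definition and
  \<open>\<alpha> n = J n n\<close>, \<open>\<beta> n = J (Suc n) n\<close>, \<open>\<gamma> n = J (n + 2) n\<close> in the second.\<close>

definition jacobi_matrix :: "(nat \<Rightarrow> nat \<Rightarrow> real) \<Rightarrow> bool"
  where "jacobi_matrix J \<longleftrightarrow>
    (\<forall>i j. J i j = J j i) \<and> (\<forall>i j. i + 1 < j \<longrightarrow> J i j = 0) \<and> (\<forall>k. J (Suc k) k > 0)"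

definition five_diagonal_matrix :: "(nat \<Rightarrow> nat \<Rightarrow> real) \<Rightarrow> bool"
  where "five_diagonal_matrix J \<longleftrightarrow>
    (\<forall>i j. J i j = J j i) \<and> (\<forall>i j. i + 2 < j \<longrightarrow> J i j = 0) \<and> (\<forall>n. J (n + 2) n > 0)"

definition jacobi_type_pencil ::
    "(nat \<Rightarrow> nat \<Rightarrow> real) \<Rightarrow> (nat \<Rightarrow> nat \<Rightarrow> real) \<Rightarrow> real \<Rightarrow> real \<Rightarrow> bool"
  where "jacobi_type_pencil J3 J5 \<alpha> \<beta> \<longleftrightarrow>
    jacobi_matrix J3 \<and> five_diagonal_matrix J5 \<and> \<alpha> > 0"

definition associated_polynomials ::
    "(nat \<Rightarrow> nat \<Rightarrow> real) \<Rightarrow> (nat \<Rightarrow> nat \<Rightarrow> real) \<Rightarrow> real \<Rightarrow> real \<Rightarrow> (nat \<Rightarrow> complex poly) \<Rightarrow> bool"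
  where "associated_polynomials J3 J5 \<alpha> \<beta> p \<longleftrightarrow>
    p 0 = 1 \<and> p 1 = [:of_real \<beta>, of_real \<alpha>:] \<and>
    (\<forall>z. mat_vec (\<lambda>i j. of_real (J5 i j) - z * of_real (J3 i j)) (\<lambda>n. poly (p n) z) = (\<lambda>n. 0))"

definition u_vec :: "(nat \<Rightarrow> nat \<Rightarrow> real) \<Rightarrow> nat \<Rightarrow> nat \<Rightarrow> complex"
  where "u_vec J3 n = mat_vec (\<lambda>i j. of_real (J3 i j)) (evec n)"

definition w_vec :: "(nat \<Rightarrow> nat \<Rightarrow> real) \<Rightarrow> nat \<Rightarrow> nat \<Rightarrow> complex"
  where "w_vec J5 n = mat_vec (\<lambda>i j. of_real (J5 i j)) (evec n)"

text \<open>The value is meaningful only for \<open>f \<in> l2_fin\<close>; there it is determined by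
  \<open>associated_operator_eq\<close> and \<open>l2_fin_expansion\<close> below.\<close>

definition associated_operator ::
    "(nat \<Rightarrow> nat \<Rightarrow> real) \<Rightarrow> (nat \<Rightarrow> nat \<Rightarrow> real) \<Rightarrow> real \<Rightarrow> real \<Rightarrow> (nat \<Rightarrow> complex) \<Rightarrow> nat \<Rightarrow> complex"
  where "associated_operator J3 J5 \<alpha> \<beta> f = (THE g. \<exists>\<zeta> \<xi>. finite {n. \<xi> n \<noteq> 0} \<and>
    f = (\<lambda>i. \<zeta> * evec 0 i + (\<Sum>n | \<xi> n \<noteq> 0. \<xi> n * u_vec J3 n i)) \<and>
    g = (\<lambda>i. \<zeta> / of_real \<alpha> * (evec 1 i - of_real \<beta> * evec 0 i)
              + (\<Sum>n | \<xi> n \<noteq> 0. \<xi> n * w_vec J5 n i)))"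

definition poly_op ::
    "complex poly \<Rightarrow> ((nat \<Rightarrow> complex) \<Rightarrow> nat \<Rightarrow> complex) \<Rightarrow> (nat \<Rightarrow> complex) \<Rightarrow> nat \<Rightarrow> complex"
  where "poly_op f A c = (\<lambda>i. \<Sum>k\<le>degree f. coeff f k * (A ^^ k) c i)"


lemma mat_vec_superset:
  assumes "finite S" "\<And>j. M i j \<noteq> 0 \<Longrightarrow> j \<in> S"
  shows "mat_vec M c i = (\<Sum>j\<in>S. M i j * c j)"
  unfolding mat_vec_def by (rule sum.mono_neutral_left) (use assms in auto)

lemma jacobi_matrix_eq_0:
  "jacobi_matrix J \<Longrightarrow> i + 1 < j \<or> j + 1 < i \<Longrightarrow> J i j = 0"
  unfolding jacobi_matrix_def by metis

lemma five_diagonal_matrix_eq_0: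
  "five_diagonal_matrix J \<Longrightarrow> i + 2 < j \<or> j + 2 < i \<Longrightarrow> J i j = 0"
  unfolding five_diagonal_matrix_def by metis

lemma u_vec_eq:
  assumes "jacobi_matrix J3"
  shows "u_vec J3 n i = of_real (J3 i n)"
proof -
  have "u_vec J3 n i = (\<Sum>j\<in>{..n + i + 1}. of_real (J3 i j) * evec n j)"
    unfolding u_vec_def
  proof (rule mat_vec_superset)
    fix j assume "complex_of_real (J3 i j) \<noteq> 0"
    then have "\<not> i + 1 < j" using jacobi_matrix_eq_0[OF assms, of i j] by auto
    then show "j \<in> {..n + i + 1}" by simp
  qed simp
  also have "\<dots> = (\<Sum>j\<in>{..n + i + 1}. if j = n then of_real (J3 i j) else 0)"
    by (rule sum.cong) (auto simp: evec_def)
  also have "\<dots> = of_real (J3 i n)" by simp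
  finally show ?thesis .
qed

lemma w_vec_eq:
  assumes "five_diagonal_matrix J5"
  shows "w_vec J5 n i = of_real (J5 i n)"
proof -
  have "w_vec J5 n i = (\<Sum>j\<in>{..n + i + 2}. of_real (J5 i j) * evec n j)"
    unfolding w_vec_def
  proof (rule mat_vec_superset)
    fix j assume "complex_of_real (J5 i j) \<noteq> 0"
    then have "\<not> i + 2 < j" using five_diagonal_matrix_eq_0[OF assms, of i j] by auto
    then show "j \<in> {..n + i + 2}" by simp
  qed simp
  also have "\<dots> = (\<Sum>j\<in>{..n + i + 2}. if j = n then of_real (J5 i j) else 0)"
    by (rule sum.cong) (auto simp: evec_def)
  also have "\<dots> = of_real (J5 i n)" by simp
  finally show ?thesis .
qed

lemma l2_fin_iff: "c \<in> l2_fin \<longleftrightarrow> finite {n. c n \<noteq> 0}"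
proof -
  have "summable (\<lambda>n. (cmod (c n))\<^sup>2)" if "finite {n. c n \<noteq> 0}"
    by (rule summable_finite[OF that]) auto
  then show ?thesis
    by (auto simp: l2_fin_def l2_def)
qed

lemma associated_polynomials_row:
  assumes "jacobi_type_pencil J3 J5 \<alpha> \<beta>"
  shows "mat_vec (\<lambda>i j. of_real (J5 i j) - z * of_real (J3 i j)) c n =
    (\<Sum>j<n + 2. (of_real (J5 n j) - z * of_real (J3 n j)) * c j) + of_real (J5 n (n + 2)) * c (n + 2)"
proof -
  have J: "jacobi_matrix J3" "five_diagonal_matrix J5"
    using assms by (auto simp: jacobi_type_pencil_def)
  have "mat_vec (\<lambda>i j. of_real (J5 i j) - z * of_real (J3 i j)) c n =
      (\<Sum>j<Suc (n + 2). (of_real (J5 n j) - z * of_real (J3 n j)) * c j)"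
  proof (rule mat_vec_superset)
    fix j assume *: "complex_of_real (J5 n j) - z * of_real (J3 n j) \<noteq> 0"
    show "j \<in> {..<Suc (n + 2)}"
    proof (rule ccontr)
      assume "j \<notin> {..<Suc (n + 2)}"
      then have "J3 n j = 0" "J5 n j = 0"
        using jacobi_matrix_eq_0[OF J(1), of n j] five_diagonal_matrix_eq_0[OF J(2), of n j] by auto
      with * show False by simp
    qed
  qed auto
  moreover have "J3 n (n + 2) = 0"
    using jacobi_matrix_eq_0[OF J(1), of n "n + 2"] by auto
  ultimately show ?thesis unfolding sum.lessThan_Suc by simp
qed

lemma associated_polynomials_scalar:
  assumes "jacobi_type_pencil J3 J5 \<alpha> \<beta>"
  shows "mat_vec (\<lambda>i j. of_real (J5 i j) - z * of_real (J3 i j)) c n =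
    (if n \<ge> 2 then of_real (J5 n (n - 2)) * c (n - 2) else 0)
    + (if n \<ge> 1 then (of_real (J5 n (n - 1)) - z * of_real (J3 n (n - 1))) * c (n - 1) else 0)
    + (of_real (J5 n n) - z * of_real (J3 n n)) * c n
    + (of_real (J5 (n + 1) n) - z * of_real (J3 (n + 1) n)) * c (n + 1)
    + of_real (J5 (n + 2) n) * c (n + 2)"
proof -
  have J: "jacobi_matrix J3" "five_diagonal_matrix J5"
    using assms by (auto simp: jacobi_type_pencil_def)
  have sym: "J5 (n + 2) n = J5 n (n + 2)" "J5 (n + 1) n = J5 n (n + 1)" "J3 (n + 1) n = J3 n (n + 1)"
    using J unfolding jacobi_matrix_def five_diagonal_matrix_def by metis+
  let ?F = "\<lambda>j. (complex_of_real (J5 n j) - z * of_real (J3 n j)) * c j"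
  have "(\<Sum>j<n + 2. ?F j) = (\<Sum>j\<in>{n - 2..<n}. ?F j) + ?F n + ?F (n + 1)"
  proof -
    have "(\<Sum>j<n. ?F j) = (\<Sum>j\<in>{n - 2..<n}. ?F j)"
    proof (rule sum.mono_neutral_right)
      show "\<forall>j\<in>{..<n} - {n - 2..<n}. ?F j = 0"
        using jacobi_matrix_eq_0[OF J(1), of n] five_diagonal_matrix_eq_0[OF J(2), of n] by auto
    qed auto
    then show ?thesis by simp
  qed
  moreover have "(\<Sum>j\<in>{n - 2..<n}. ?F j) =
      (if n \<ge> 2 then of_real (J5 n (n - 2)) * c (n - 2) else 0) + (if n \<ge> 1 then ?F (n - 1) else 0)"
  proof (cases "n \<ge> 2")
    case True
    then obtain k where k: "n = k + 2" using le_Suc_ex by (metis add.commute)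
    have "J3 n (n - 2) = 0"
      by (rule jacobi_matrix_eq_0[OF J(1)]) (use True in linarith)
    moreover have "{n - 2..<n} = {k, k + 1}" using k by auto
    ultimately show ?thesis using k by simp
  next
    case False
    then have "n = 0 \<or> n = 1" by auto
    then show ?thesis by auto
  qed
  ultimately show ?thesis
    using associated_polynomials_row[OF assms, of z c n] sym by (simp add: algebra_simps)
qed

fun assoc_poly ::
    "(nat \<Rightarrow> nat \<Rightarrow> real) \<Rightarrow> (nat \<Rightarrow> nat \<Rightarrow> real) \<Rightarrow> real \<Rightarrow> real \<Rightarrow> nat \<Rightarrow> complex poly"
  where "assoc_poly J3 J5 \<alpha> \<beta> n =
    (if n = 0 then 1 else if n = 1 then [:of_real \<beta>, of_real \<alpha>:]
     else smult (- 1 / of_real (J5 (n - 2) n))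
       (\<Sum>j<n. [:of_real (J5 (n - 2) j), - of_real (J3 (n - 2) j):] * assoc_poly J3 J5 \<alpha> \<beta> j))"

declare assoc_poly.simps [simp del]

lemma associated_polynomials_ex1:
  assumes "jacobi_type_pencil J3 J5 \<alpha> \<beta>"
  shows "\<exists>!p. associated_polynomials J3 J5 \<alpha> \<beta> p"
proof (rule ex1I)
  have nz: "J5 n (n + 2) \<noteq> 0" for n
    using assms unfolding jacobi_type_pencil_def five_diagonal_matrix_def by (metis less_irrefl)
  have init: "assoc_poly J3 J5 \<alpha> \<beta> 0 = 1" "assoc_poly J3 J5 \<alpha> \<beta> 1 = [:of_real \<beta>, of_real \<alpha>:]"
    by (subst assoc_poly.simps, simp)+
  have rec: "poly (assoc_poly J3 J5 \<alpha> \<beta> (n + 2)) z =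
      - (\<Sum>j<n + 2. (of_real (J5 n j) - z * of_real (J3 n j)) * poly (assoc_poly J3 J5 \<alpha> \<beta> j) z)
      / of_real (J5 n (n + 2))" for n z
    by (subst assoc_poly.simps) (simp add: poly_sum algebra_simps del: sum.lessThan_Suc)
  show "associated_polynomials J3 J5 \<alpha> \<beta> (assoc_poly J3 J5 \<alpha> \<beta>)"
    unfolding associated_polynomials_def
  proof (intro conjI allI ext)
    fix z n
    show "mat_vec (\<lambda>i j. of_real (J5 i j) - z * of_real (J3 i j))
        (\<lambda>n. poly (assoc_poly J3 J5 \<alpha> \<beta> n) z) n = 0"
      unfolding associated_polynomials_row[OF assms] rec using nz[of n] by simp
  qed (use init in auto)
  fix p assume p: "associated_polynomials J3 J5 \<alpha> \<beta> p"
  have "p n = assoc_poly J3 J5 \<alpha> \<beta> n" for n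
  proof (induction n rule: less_induct)
    case (less n)
    consider "n = 0" | "n = 1" | k where "n = k + 2"
      by (metis One_nat_def add_2_eq_Suc' not0_implies_Suc)
    then show ?case
    proof cases
      case 3
      have "poly (p n) z = poly (assoc_poly J3 J5 \<alpha> \<beta> n) z" for z
      proof -
        let ?S = "\<Sum>j<k + 2. (of_real (J5 k j) - z * of_real (J3 k j)) * poly (p j) z"
        have "mat_vec (\<lambda>i j. of_real (J5 i j) - z * of_real (J3 i j)) (\<lambda>n. poly (p n) z) k = 0"
          using p unfolding associated_polynomials_def by metis
        then have "?S + of_real (J5 k (k + 2)) * poly (p n) z = 0"
          unfolding associated_polynomials_row[OF assms] 3 .
        then have "poly (p n) z = - ?S / of_real (J5 k (k + 2))"
          using nz[of k] by (simp add: field_simps add_eq_0_iff2)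
        also have "?S = (\<Sum>j<k + 2. (of_real (J5 k j) - z * of_real (J3 k j)) *
            poly (assoc_poly J3 J5 \<alpha> \<beta> j) z)"
          using less 3 by (intro sum.cong) auto
        also have "- \<dots> / of_real (J5 k (k + 2)) = poly (assoc_poly J3 J5 \<alpha> \<beta> n) z"
          unfolding 3 rec ..
        finally show ?thesis .
      qed
      then show ?thesis by (simp add: poly_eq_poly_eq_iff[symmetric] fun_eq_iff)
    qed (use p init in \<open>auto simp: associated_polynomials_def\<close>)
  qed
  then show "p = assoc_poly J3 J5 \<alpha> \<beta>" by auto
qed

lemma l2_fin_expansion:
  assumes "jacobi_matrix J3" "f \<in> l2_fin"
  shows "\<exists>\<zeta> \<xi>. finite {n. \<xi> n \<noteq> 0} \<and>
    f = (\<lambda>i. \<zeta> * evec 0 i + (\<Sum>n | \<xi> n \<noteq> 0. \<xi> n * u_vec J3 n i))"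
proof -
  have *: "\<exists>\<zeta> \<xi>. (\<forall>n\<ge>N. \<xi> n = 0) \<and> f = (\<lambda>i. \<zeta> * evec 0 i + (\<Sum>n<N. \<xi> n * u_vec J3 n i))"
    if "\<forall>i>N. f i = 0" for N f
    using that
  proof (induction N arbitrary: f)
    case 0
    then show ?case
      by (intro exI[of _ "f 0"] exI[of _ "\<lambda>_. 0"]) (auto simp: evec_def fun_eq_iff)
  next
    case (Suc N)
    have a: "J3 (Suc N) N \<noteq> 0"
      using assms(1) unfolding jacobi_matrix_def by (metis less_irrefl)
    define x where "x = f (Suc N) / of_real (J3 (Suc N) N)"
    have "\<forall>i>N. f i - x * u_vec J3 N i = 0"
    proof (intro allI impI)
      fix i assume "N < i"
      then consider "i = Suc N" | "i > Suc N" by linarith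
      then show "f i - x * u_vec J3 N i = 0"
      proof cases
        case 1
        then show ?thesis using a by (simp add: x_def u_vec_eq[OF assms(1)])
      next
        case 2
        then have "J3 i N = 0" by (intro jacobi_matrix_eq_0[OF assms(1)]) auto
        with 2 show ?thesis using Suc.prems by (simp add: u_vec_eq[OF assms(1)])
      qed
    qed
    from Suc.IH[OF this] obtain \<zeta> \<xi> where 1: "\<forall>n\<ge>N. \<xi> n = 0"
      "(\<lambda>i. f i - x * u_vec J3 N i) = (\<lambda>i. \<zeta> * evec 0 i + (\<Sum>n<N. \<xi> n * u_vec J3 n i))"
      by blast
    have "f i = \<zeta> * evec 0 i + (\<Sum>n<Suc N. (\<xi>(N := x)) n * u_vec J3 n i)" for i
    proof -
      have "(\<Sum>n<N. (\<xi>(N := x)) n * u_vec J3 n i) = (\<Sum>n<N. \<xi> n * u_vec J3 n i)"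
        by (rule sum.cong) auto
      then show ?thesis using fun_cong[OF 1(2), of i] by (simp add: algebra_simps)
    qed
    then show ?case using 1(1)
      by (intro exI[of _ \<zeta>] exI[of _ "\<xi>(N := x)"]) auto
  qed
  obtain N where "\<forall>i>N. f i = 0"
    using assms(2) unfolding l2_fin_iff finite_nat_set_iff_bounded_le
    by (metis (mono_tags, lifting) mem_Collect_eq not_le)
  from *[OF this] obtain \<zeta> \<xi> where 1: "\<forall>n\<ge>N. \<xi> n = 0"
    "f = (\<lambda>i. \<zeta> * evec 0 i + (\<Sum>n<N. \<xi> n * u_vec J3 n i))" by blast
  have sub: "{n. \<xi> n \<noteq> 0} \<subseteq> {..<N}" using 1(1) by (auto simp: not_le[symmetric])
  then have "(\<Sum>n | \<xi> n \<noteq> 0. \<xi> n * u_vec J3 n i) = (\<Sum>n<N. \<xi> n * u_vec J3 n i)" for i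
    by (intro sum.mono_neutral_left) auto
  then show ?thesis using 1(2) sub finite_subset by (intro exI[of _ \<zeta>] exI[of _ \<xi>]) auto
qed

lemma l2_fin_expansion_unique:
  assumes J: "jacobi_matrix J3" and fin: "finite {n. \<xi> n \<noteq> 0}" "finite {n. \<xi>' n \<noteq> 0}"
    and eq: "(\<lambda>i. \<zeta> * evec 0 i + (\<Sum>n | \<xi> n \<noteq> 0. \<xi> n * u_vec J3 n i)) =
      (\<lambda>i. \<zeta>' * evec 0 i + (\<Sum>n | \<xi>' n \<noteq> 0. \<xi>' n * u_vec J3 n i))"
  shows "\<zeta> = \<zeta>' \<and> \<xi> = \<xi>'"
proof -
  let ?S = "{n. \<xi> n \<noteq> 0} \<union> {n. \<xi>' n \<noteq> 0}"
  have S: "(\<Sum>n | \<xi> n \<noteq> 0. \<xi> n * u_vec J3 n i) = (\<Sum>n\<in>?S. \<xi> n * u_vec J3 n i)"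
    "(\<Sum>n | \<xi>' n \<noteq> 0. \<xi>' n * u_vec J3 n i) = (\<Sum>n\<in>?S. \<xi>' n * u_vec J3 n i)" for i
    using fin by (auto intro!: sum.mono_neutral_left)
  have d: "(\<zeta> - \<zeta>') * evec 0 i + (\<Sum>n\<in>?S. (\<xi> n - \<xi>' n) * u_vec J3 n i) = 0" for i
    using fun_cong[OF eq, of i] unfolding S by (simp add: algebra_simps sum_subtractf)
  have "\<xi> = \<xi>'"
  proof (rule ccontr)
    assume "\<xi> \<noteq> \<xi>'"
    define D where "D = {n. \<xi> n \<noteq> \<xi>' n}"
    have "D \<subseteq> ?S" by (auto simp: D_def)
    then have D: "finite D" "D \<noteq> {}"
      using \<open>\<xi> \<noteq> \<xi>'\<close> finite_subset fin by (blast, auto simp: D_def)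
    define m where "m = Max D"
    have m: "m \<in> D" "\<And>n. n \<in> D \<Longrightarrow> n \<le> m" using D by (auto simp: m_def)
    have "(\<Sum>n\<in>?S. (\<xi> n - \<xi>' n) * u_vec J3 n (Suc m)) =
        (\<Sum>n\<in>{m}. (\<xi> n - \<xi>' n) * u_vec J3 n (Suc m))"
    proof (rule sum.mono_neutral_right)
      show "\<forall>n\<in>?S - {m}. (\<xi> n - \<xi>' n) * u_vec J3 n (Suc m) = 0"
      proof
        fix n assume n: "n \<in> ?S - {m}"
        show "(\<xi> n - \<xi>' n) * u_vec J3 n (Suc m) = 0"
        proof (cases "n \<in> D")
          case True
          then have "n < m" using m(2)[OF True] n by auto
          then show ?thesis
            using jacobi_matrix_eq_0[OF J, of "Suc m" n] by (simp add: u_vec_eq[OF J])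
        qed (auto simp: D_def)
      qed
    qed (use fin m(1) in \<open>auto simp: D_def\<close>)
    then have "(\<xi> m - \<xi>' m) * of_real (J3 (Suc m) m) = 0"
      using d[of "Suc m"] by (simp add: evec_def u_vec_eq[OF J])
    moreover have "J3 (Suc m) m \<noteq> 0"
      using J unfolding jacobi_matrix_def by (metis less_irrefl)
    ultimately show False using m(1) by (auto simp: D_def)
  qed
  with d[of 0] show ?thesis by (simp add: evec_def)
qed

lemma associated_operator_eq:
  assumes "jacobi_matrix J3" "finite {n. \<xi> n \<noteq> 0}"
    and "f = (\<lambda>i. \<zeta> * evec 0 i + (\<Sum>n | \<xi> n \<noteq> 0. \<xi> n * u_vec J3 n i))"
  shows "associated_operator J3 J5 \<alpha> \<beta> f =
    (\<lambda>i. \<zeta> / of_real \<alpha> * (evec 1 i - of_real \<beta> * evec 0 i)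
       + (\<Sum>n | \<xi> n \<noteq> 0. \<xi> n * w_vec J5 n i))"
  unfolding associated_operator_def
proof (rule the_equality)
  fix g assume "\<exists>\<zeta>' \<xi>'. finite {n. \<xi>' n \<noteq> 0} \<and>
    f = (\<lambda>i. \<zeta>' * evec 0 i + (\<Sum>n | \<xi>' n \<noteq> 0. \<xi>' n * u_vec J3 n i)) \<and>
    g = (\<lambda>i. \<zeta>' / of_real \<alpha> * (evec 1 i - of_real \<beta> * evec 0 i)
       + (\<Sum>n | \<xi>' n \<noteq> 0. \<xi>' n * w_vec J5 n i))"
  then obtain \<zeta>' \<xi>' where *: "finite {n. \<xi>' n \<noteq> 0}"
    "f = (\<lambda>i. \<zeta>' * evec 0 i + (\<Sum>n | \<xi>' n \<noteq> 0. \<xi>' n * u_vec J3 n i))"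
    "g = (\<lambda>i. \<zeta>' / of_real \<alpha> * (evec 1 i - of_real \<beta> * evec 0 i)
       + (\<Sum>n | \<xi>' n \<noteq> 0. \<xi>' n * w_vec J5 n i))"
    by blast
  have "\<zeta> = \<zeta>' \<and> \<xi> = \<xi>'"
    by (rule l2_fin_expansion_unique[OF assms(1,2) *(1) trans[OF assms(3)[symmetric] *(2)]])
  then show "g = (\<lambda>i. \<zeta> / of_real \<alpha> * (evec 1 i - of_real \<beta> * evec 0 i)
       + (\<Sum>n | \<xi> n \<noteq> 0. \<xi> n * w_vec J5 n i))"
    using *(3) by simp
qed (intro exI conjI; (rule assms refl)+)

lemma associated_operator_l2_fin:
  assumes "jacobi_matrix J3" "five_diagonal_matrix J5" "f \<in> l2_fin"
  shows "associated_operator J3 J5 \<alpha> \<beta> f \<in> l2_fin"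
proof -
  obtain \<zeta> \<xi> where *: "finite {n. \<xi> n \<noteq> 0}"
    "f = (\<lambda>i. \<zeta> * evec 0 i + (\<Sum>n | \<xi> n \<noteq> 0. \<xi> n * u_vec J3 n i))"
    using l2_fin_expansion[OF assms(1,3)] by blast
  let ?W = "{0, 1} \<union> (\<Union>n\<in>{n. \<xi> n \<noteq> 0}. {..n + 2})"
  have "associated_operator J3 J5 \<alpha> \<beta> f i = 0" if "i \<notin> ?W" for i
  proof -
    have "w_vec J5 n i = 0" if "\<xi> n \<noteq> 0" for n
    proof -
      have "n + 2 < i" using that \<open>i \<notin> ?W\<close> by auto
      then show ?thesis
        using five_diagonal_matrix_eq_0[OF assms(2), of i n] by (simp add: w_vec_eq[OF assms(2)])
    qed
    then show ?thesis
      using that by (simp add: associated_operator_eq[OF assms(1) *] evec_def)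
  qed
  then have "{i. associated_operator J3 J5 \<alpha> \<beta> f i \<noteq> 0} \<subseteq> ?W" by blast
  moreover have "finite ?W" using *(1) by simp
  ultimately show ?thesis unfolding l2_fin_iff by (rule finite_subset)
qed

end

(* The orthonormality holds because p_n(A) e_0 = e_n.  Row n of the pencil recurrence, with
   lambda replaced by A and applied to e_0, reads by induction
   w_n - gamma_n e_(n+2) - A u_n + gamma_n p_(n+2)(A) e_0 = 0, and A u_n = w_n. *)

theory Submission
  imports Defs
begin

section \<open>Finitely supported sequences and the orthonormal unit vectors\<close>

lemma l2_fin_evec: "evec n \<in> l2_fin"
  by (simp add: l2_fin_iff evec_def)

lemma l2_fin_zero: "(\<lambda>i. 0) \<in> l2_fin"
  by (simp add: l2_fin_iff)

lemma l2_fin_add_scaled: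
  assumes "f \<in> l2_fin" "g \<in> l2_fin"
  shows "(\<lambda>i. f i + c * g i) \<in> l2_fin"
proof -
  have "{i. f i + c * g i \<noteq> 0} \<subseteq> {i. f i \<noteq> 0} \<union> {i. g i \<noteq> 0}" by auto
  then show ?thesis using assms finite_subset unfolding l2_fin_iff by blast
qed

lemma l2_fin_sum:
  assumes "\<And>j. j \<in> S \<Longrightarrow> f j \<in> l2_fin"
  shows "(\<lambda>i. \<Sum>j\<in>S. x j * f j i) \<in> l2_fin"
  using assms
proof (induction S rule: infinite_finite_induct)
  case (insert j S)
  then have "(\<lambda>i. (\<Sum>j\<in>S. x j * f j i) + x j * f j i) \<in> l2_fin"
    by (intro l2_fin_add_scaled) auto
  with insert.hyps show ?case by (simp add: add.commute)
qed (simp_all add: l2_fin_zero)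

lemma l2_inner_evec: "l2_inner (evec n) (evec m) = (if n = m then 1 else 0)"
proof -
  have "l2_inner (evec n) (evec m) = (\<Sum>k\<in>{n}. evec n k * cnj (evec m k))"
    unfolding l2_inner_def by (rule suminf_finite) (auto simp: evec_def)
  then show ?thesis by (simp add: evec_def)
qed

section \<open>Linearity of the associated operator on \<open>l2_fin\<close>\<close>

text \<open>Frees the index set from the exact support of \<open>\<xi>\<close>, so that several
  expansions can be written over one common set.\<close>

lemma associated_operator_eq_superset:
  assumes "jacobi_matrix J3" "finite S" "\<And>n. n \<notin> S \<Longrightarrow> \<xi> n = 0"
    and "f = (\<lambda>i. \<zeta> * evec 0 i + (\<Sum>n\<in>S. \<xi> n * u_vec J3 n i))"
  shows "associated_operator J3 J5 \<alpha> \<beta> f =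
    (\<lambda>i. \<zeta> / of_real \<alpha> * (evec 1 i - of_real \<beta> * evec 0 i) + (\<Sum>n\<in>S. \<xi> n * w_vec J5 n i))"
proof -
  have sub: "{n. \<xi> n \<noteq> 0} \<subseteq> S" using assms(3) by blast
  have sums: "(\<Sum>n\<in>S. \<xi> n * v n) = (\<Sum>n | \<xi> n \<noteq> 0. \<xi> n * v n)" for v
    by (rule sum.mono_neutral_right) (use sub assms(2) in auto)
  show ?thesis unfolding sums
    by (rule associated_operator_eq[OF assms(1) finite_subset[OF sub assms(2)]])
      (simp add: assms(4) sums)
qed

lemma associated_operator_evec_0:
  assumes "jacobi_matrix J3"
  shows "associated_operator J3 J5 \<alpha> \<beta> (evec 0) =
    (\<lambda>i. (evec 1 i - of_real \<beta> * evec 0 i) / of_real \<alpha>)"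
  by (subst associated_operator_eq_superset[OF assms, of "{}" "\<lambda>_. 0" _ 1]) simp_all

lemma associated_operator_u_vec:
  assumes "jacobi_matrix J3"
  shows "associated_operator J3 J5 \<alpha> \<beta> (u_vec J3 n) = w_vec J5 n"
  by (subst associated_operator_eq_superset[OF assms, of "{n}" "\<lambda>k. if k = n then 1 else 0" _ 0])
    simp_all

text \<open>The coordinates with respect to \<open>evec 0\<close> and the \<open>u_vec J3 n\<close>
  combine linearly, and the operator only replaces these basis vectors by fixed images. One combined
  form covers both addition and scaling.\<close>

lemma associated_operator_add_scaled:
  assumes "jacobi_matrix J3" "f \<in> l2_fin" "g \<in> l2_fin"
  shows "associated_operator J3 J5 \<alpha> \<beta> (\<lambda>i. f i + c * g i) =
    (\<lambda>i. associated_operator J3 J5 \<alpha> \<beta> f i + c * associated_operator J3 J5 \<alpha> \<beta> g i)"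
proof -
  obtain \<zeta> \<xi> where f: "finite {n. \<xi> n \<noteq> 0}"
    "f = (\<lambda>i. \<zeta> * evec 0 i + (\<Sum>n | \<xi> n \<noteq> 0. \<xi> n * u_vec J3 n i))"
    using l2_fin_expansion[OF assms(1,2)] by blast
  obtain \<zeta>' \<xi>' where g: "finite {n. \<xi>' n \<noteq> 0}"
    "g = (\<lambda>i. \<zeta>' * evec 0 i + (\<Sum>n | \<xi>' n \<noteq> 0. \<xi>' n * u_vec J3 n i))"
    using l2_fin_expansion[OF assms(1,3)] by blast
  \<comment> \<open>The supports of the two expansions may differ, and coefficients may cancel in
    \<open>\<xi> n + c * \<xi>' n\<close>; the union serves for all three expansions.\<close>
  define S where "S = {n. \<xi> n \<noteq> 0} \<union> {n. \<xi>' n \<noteq> 0}"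
  have S: "finite S" using f(1) g(1) by (simp add: S_def)
  have off: "\<xi> n = 0" "\<xi>' n = 0" if "n \<notin> S" for n using that by (auto simp: S_def)
  have fS: "f = (\<lambda>i. \<zeta> * evec 0 i + (\<Sum>n\<in>S. \<xi> n * u_vec J3 n i))"
    unfolding f(2) using S by (auto simp: fun_eq_iff S_def intro!: sum.mono_neutral_left)
  have gS: "g = (\<lambda>i. \<zeta>' * evec 0 i + (\<Sum>n\<in>S. \<xi>' n * u_vec J3 n i))"
    unfolding g(2) using S by (auto simp: fun_eq_iff S_def intro!: sum.mono_neutral_left)
  have fgS: "(\<lambda>i. f i + c * g i) =
      (\<lambda>i. (\<zeta> + c * \<zeta>') * evec 0 i + (\<Sum>n\<in>S. (\<xi> n + c * \<xi>' n) * u_vec J3 n i))"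
    unfolding fS gS by (simp add: fun_eq_iff algebra_simps sum.distrib sum_distrib_left)
  let ?A = "associated_operator J3 J5 \<alpha> \<beta>"
  let ?e = "\<lambda>i. evec 1 i - of_real \<beta> * evec 0 i"
  have Af: "?A f = (\<lambda>i. \<zeta> / of_real \<alpha> * ?e i + (\<Sum>n\<in>S. \<xi> n * w_vec J5 n i))"
    by (rule associated_operator_eq_superset[OF assms(1) S _ fS]) (rule off)
  have Ag: "?A g = (\<lambda>i. \<zeta>' / of_real \<alpha> * ?e i + (\<Sum>n\<in>S. \<xi>' n * w_vec J5 n i))"
    by (rule associated_operator_eq_superset[OF assms(1) S _ gS]) (rule off)
  have "?A (\<lambda>i. f i + c * g i) =
      (\<lambda>i. (\<zeta> + c * \<zeta>') / of_real \<alpha> * ?e i + (\<Sum>n\<in>S. (\<xi> n + c * \<xi>' n) * w_vec J5 n i))"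
    by (rule associated_operator_eq_superset[OF assms(1) S _ fgS]) (simp add: off)
  then show ?thesis unfolding Af Ag
    by (simp add: fun_eq_iff algebra_simps sum.distrib sum_distrib_left add_divide_distrib)
qed

lemma associated_operator_sum:
  assumes "jacobi_matrix J3" "\<And>j. j \<in> S \<Longrightarrow> f j \<in> l2_fin"
  shows "associated_operator J3 J5 \<alpha> \<beta> (\<lambda>i. \<Sum>j\<in>S. x j * f j i) =
    (\<lambda>i. \<Sum>j\<in>S. x j * associated_operator J3 J5 \<alpha> \<beta> (f j) i)"
proof -
  let ?A = "associated_operator J3 J5 \<alpha> \<beta>"
  \<comment> \<open>Writing 0 as 0 + (-1) * 0 gives A 0 = A 0 - A 0, which vanishes.\<close>
  have zero: "?A (\<lambda>i. 0) = (\<lambda>i. 0)"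
    using associated_operator_add_scaled[OF assms(1) l2_fin_zero l2_fin_zero, of J5 \<alpha> \<beta> "- 1"]
    by simp
  show ?thesis using assms(2)
  proof (induction S rule: infinite_finite_induct)
    case (insert j S)
    then have "?A (\<lambda>i. (\<Sum>j\<in>S. x j * f j i) + x j * f j i) =
        (\<lambda>i. (\<Sum>j\<in>S. x j * ?A (f j) i) + x j * ?A (f j) i)"
      by (subst associated_operator_add_scaled[OF assms(1)]) (auto intro: l2_fin_sum)
    with insert.hyps show ?case by (simp add: add.commute)
  qed (simp_all add: zero)
qed

section \<open>Calculus of polynomials in an operator\<close>

text \<open>A mere degree bound is enough, so the laws below survive a drop in degree, as when
  leading terms cancel in \<open>f + g\<close>.\<close>

lemma poly_op_superset:
  assumes "degree f \<le> N"
  shows "poly_op f A c i = (\<Sum>k\<le>N. coeff f k * (A ^^ k) c i)"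
  unfolding poly_op_def
  by (rule sum.mono_neutral_left) (use assms in \<open>auto simp: coeff_eq_0\<close>)

lemma poly_op_add: "poly_op (f + g) A c i = poly_op f A c i + poly_op g A c i"
proof -
  let ?N = "max (degree f) (degree g)"
  show ?thesis
    by (simp add: poly_op_superset[of f ?N] poly_op_superset[of g ?N]
        poly_op_superset[of "f + g" ?N] degree_add_le_max sum.distrib algebra_simps)
qed

lemma poly_op_smult: "poly_op (smult x f) A c i = x * poly_op f A c i"
  by (simp add: poly_op_superset[of "smult x f" "degree f"] degree_smult_le
      poly_op_superset[of f "degree f"] sum_distrib_left mult.assoc)

lemma poly_op_0: "poly_op 0 A c i = 0"
  by (simp add: poly_op_def)

lemma poly_op_1: "poly_op 1 A c = c"
  by (simp add: poly_op_def fun_eq_iff)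

lemma poly_op_sum: "poly_op (\<Sum>j\<in>S. f j) A c i = (\<Sum>j\<in>S. poly_op (f j) A c i)"
  by (induction S rule: infinite_finite_induct) (simp_all add: poly_op_0 poly_op_add)

text \<open>Multiplication by lambda turns into application of \<open>A\<close>: pulling
  \<open>A\<close> out of the finite sum of powers is exactly linearity, which is available because
  all vectors involved stay in \<open>l2_fin\<close>.\<close>

lemma poly_op_pCons_0:
  assumes "jacobi_matrix J3" "five_diagonal_matrix J5" "c \<in> l2_fin"
    and A: "A = associated_operator J3 J5 \<alpha> \<beta>"
  shows "poly_op (pCons 0 f) A c = A (poly_op f A c)"
proof -
  have powers: "(A ^^ k) c \<in> l2_fin" for k
    by (induction k) (simp_all add: assms(1-3) A associated_operator_l2_fin)
  \<comment> \<open>The bound \<open>Suc (degree f)\<close> also covers \<open>f = 0\<close>, where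
    \<open>pCons 0 f\<close> has degree 0. The constant term is 0, so the index shifts by
    one.\<close>
  have "poly_op (pCons 0 f) A c i = (\<Sum>k\<le>degree f. coeff f k * A ((A ^^ k) c) i)" for i
    by (subst poly_op_superset[of _ "Suc (degree f)"])
      (simp_all add: degree_pCons_le sum.atMost_Suc_shift del: sum.atMost_Suc)
  moreover have "A (poly_op f A c) = (\<lambda>i. \<Sum>k\<le>degree f. coeff f k * A ((A ^^ k) c) i)"
    unfolding poly_op_def A
    by (rule associated_operator_sum[OF assms(1)]) (use powers A in simp)
  ultimately show ?thesis by (simp add: fun_eq_iff)
qed

section \<open>The recurrence as a polynomial identity, and its value at the operator\<close>

text \<open>The definition gives the recurrence only at each complex number. Since complex
  polynomials are determined by their values, it holds between polynomials, and there
  \<open>A\<close> can be substituted for lambda; lambda times \<open>p j\<close> appears as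
  \<open>pCons 0 (p j)\<close>.\<close>

lemma associated_polynomials_rec:
  assumes "jacobi_type_pencil J3 J5 \<alpha> \<beta>" "associated_polynomials J3 J5 \<alpha> \<beta> p"
  shows "(\<Sum>j<n + 2. smult (of_real (J5 n j)) (p j) + smult (- of_real (J3 n j)) (pCons 0 (p j)))
    + smult (of_real (J5 n (n + 2))) (p (n + 2)) = 0"
    (is "?q = 0")
proof -
  have "poly ?q z = 0" for z
  proof -
    have "mat_vec (\<lambda>i j. of_real (J5 i j) - z * of_real (J3 i j)) (\<lambda>n. poly (p n) z) n = 0"
      using assms(2) unfolding associated_polynomials_def by metis
    then show ?thesis
      unfolding associated_polynomials_row[OF assms(1)]
      by (simp add: poly_sum algebra_simps del: sum.lessThan_Suc)
  qed
  then show ?thesis by (simp add: poly_eq_poly_eq_iff[symmetric] fun_eq_iff)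
qed

lemma sum_evec:
  assumes "finite S" "i \<notin> S \<Longrightarrow> v i = 0"
  shows "(\<Sum>j\<in>S. v j * evec j i) = v i"
proof -
  have "(\<Sum>j\<in>S. v j * evec j i) = (\<Sum>j\<in>S. if i = j then v j else 0)"
    by (rule sum.cong) (auto simp: evec_def)
  with assms show ?thesis by (auto simp: sum.delta')
qed

lemma poly_op_associated_polynomial_evec_0:
  assumes pencil: "jacobi_type_pencil J3 J5 \<alpha> \<beta>" and p: "associated_polynomials J3 J5 \<alpha> \<beta> p"
    and A: "A = associated_operator J3 J5 \<alpha> \<beta>"
  shows "poly_op (p n) A (evec 0) = evec n"
proof (induction n rule: less_induct)
  case (less n)
  have J: "jacobi_matrix J3" "five_diagonal_matrix J5" and "\<alpha> > 0"
    using pencil by (auto simp: jacobi_type_pencil_def)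
  consider "n = 0" | "n = 1" | k where "n = k + 2"
    by (metis One_nat_def add_2_eq_Suc' not0_implies_Suc)
  then show ?case
  proof cases
    case 1
    with p show ?thesis by (simp add: associated_polynomials_def poly_op_1)
  next
    case 2
    \<comment> \<open>The prescribed image of \<open>evec 0\<close> is the one for which alpha A e_0
      + beta e_0 = e_1; dividing by alpha is legitimate as \<alpha> > 0.\<close>
    have "poly_op [:of_real \<beta>, of_real \<alpha>:] A (evec 0) i = evec 1 i" for i
      using \<open>\<alpha> > 0\<close> by (simp add: poly_op_def A associated_operator_evec_0[OF J(1)])
    with 2 p show ?thesis by (auto simp: associated_polynomials_def)
  next
    case 3
    have nz: "J5 k (k + 2) \<noteq> 0"
      using J(2) unfolding five_diagonal_matrix_def by (metis less_irrefl)
    \<comment> \<open>The recurrence runs along row \<open>k\<close>, whereas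
      \<open>u_vec J3 k\<close> and \<open>w_vec J5 k\<close> are columns.\<close>
    have sym: "J3 i k = J3 k i" "J5 i k = J5 k i" for i
      using J unfolding jacobi_matrix_def five_diagonal_matrix_def by metis+
    \<comment> \<open>Row \<open>k\<close> of \<open>J3\<close> ends at column \<open>k + 1\<close>,
      so the sum up to there is already complete.\<close>
    have u: "(\<lambda>i. \<Sum>j<k + 2. of_real (J3 k j) * evec j i) = u_vec J3 k"
    proof
      fix i show "(\<Sum>j<k + 2. of_real (J3 k j) * evec j i) = u_vec J3 k i"
        by (subst sum_evec[where v = "\<lambda>j. of_real (J3 k j)"])
          (auto simp: jacobi_matrix_eq_0[OF J(1)] u_vec_eq[OF J(1)] sym)
    qed
    \<comment> \<open>Row \<open>k\<close> of \<open>J5\<close> reaches one column further, to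
      \<open>n = k + 2\<close>; that entry is kept apart because it multiplies the polynomial still
      to be determined.\<close>
    have w: "(\<Sum>j<k + 2. of_real (J5 k j) * evec j i) + of_real (J5 k n) * evec n i = w_vec J5 k i"
      for i
    proof -
      have "(\<Sum>j<Suc (k + 2). of_real (J5 k j) * evec j i) = w_vec J5 k i"
        by (subst sum_evec[where v = "\<lambda>j. of_real (J5 k j)"])
          (auto simp: five_diagonal_matrix_eq_0[OF J(2)] w_vec_eq[OF J(2)] sym)
      then show ?thesis unfolding 3 sum.lessThan_Suc .
    qed
    \<comment> \<open>The single vectors \<open>A (evec j)\<close> need not be computed: only their
      combination along row \<open>k\<close> occurs, and by linearity it is the image of
      \<open>u_vec J3 k\<close>.\<close>
    have Au: "(\<lambda>i. \<Sum>j<k + 2. of_real (J3 k j) * A (evec j) i) = w_vec J5 k"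
      using associated_operator_sum[OF J(1), of "{..<k + 2}" evec J5 \<alpha> \<beta> "\<lambda>j. of_real (J3 k j)"]
      by (simp only: u A associated_operator_u_vec[OF J(1)] l2_fin_evec)
    have "poly_op (p n) A (evec 0) i = evec n i" for i
    proof -
      have "0 = poly_op ((\<Sum>j<k + 2. smult (of_real (J5 k j)) (p j)
            + smult (- of_real (J3 k j)) (pCons 0 (p j)))
          + smult (of_real (J5 k n)) (p n)) A (evec 0) i"
        unfolding 3 associated_polynomials_rec[OF pencil p] by (simp add: poly_op_0)
      also have "\<dots> = (\<Sum>j<k + 2. of_real (J5 k j) * poly_op (p j) A (evec 0) i
            - of_real (J3 k j) * A (poly_op (p j) A (evec 0)) i)
          + of_real (J5 k n) * poly_op (p n) A (evec 0) i"
        by (simp only: poly_op_add poly_op_sum poly_op_smult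
            poly_op_pCons_0[OF J l2_fin_evec A]) simp
      \<comment> \<open>All indices here are below \<open>n\<close>, so the induction hypothesis
        applies, also inside \<open>A\<close>.\<close>
      also have "(\<Sum>j<k + 2. of_real (J5 k j) * poly_op (p j) A (evec 0) i
            - of_real (J3 k j) * A (poly_op (p j) A (evec 0)) i) =
          (\<Sum>j<k + 2. of_real (J5 k j) * evec j i - of_real (J3 k j) * A (evec j) i)"
        by (rule sum.cong) (use less 3 in auto)
      also have "\<dots> = (\<Sum>j<k + 2. of_real (J5 k j) * evec j i) - w_vec J5 k i"
        by (simp only: sum_subtractf fun_cong[OF Au])
      \<comment> \<open>The two copies of \<open>w_vec J5 k\<close> cancel, leaving only the entry
        that was kept apart; its coefficient is nonzero and can then be divided out.\<close>
      also have "\<dots> = - (of_real (J5 k n) * evec n i)"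
        unfolding w[symmetric] by simp
      finally have "of_real (J5 k n) * poly_op (p n) A (evec 0) i = of_real (J5 k n) * evec n i"
        by simp
      with nz 3 show ?thesis by simp
    qed
    then show ?thesis by blast
  qed
qed

theorem mainTheorem3:
  fixes J3 J5 :: "nat \<Rightarrow> nat \<Rightarrow> real" and \<alpha> \<beta> :: real and p :: "nat \<Rightarrow> complex poly"
    and A :: "(nat \<Rightarrow> complex) \<Rightarrow> nat \<Rightarrow> complex" and n m :: nat
  assumes "jacobi_type_pencil J3 J5 \<alpha> \<beta>"
    and "associated_polynomials J3 J5 \<alpha> \<beta> p"
    and "A = associated_operator J3 J5 \<alpha> \<beta>"
  shows "l2_inner (poly_op (p n) A (evec 0)) (poly_op (p m) A (evec 0)) = (if n = m then 1 else 0)"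
  by (simp only: poly_op_associated_polynomial_evec_0[OF assms] l2_inner_evec)

end
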